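(* For all integers $N,M\ge 0$, there is exactly one Markov kernel $\Lambda$ from $\{0,\dots,N\}$ to $\{0,\dots,M\}$ such that $L_N\Lambda=\Lambda D_M$, and it is trivial, i.e. all its rows $\Lambda(x,\cdot)$, $x\in\{0,\dots,N\}$, are the same probability distribution on $\{0,\dots,M\}$.
   Context: For an integer $N\ge 0$, the Ehrenfest generator $L_N$ is the $\{0,\dots,N\}\times\{0,\dots,N\}$ matrix whose off-diagonal entries are $L_N(x,x+1)=\frac{N-x}{2}$, $L_N(x,x-1)=\frac{x}{2}$, and $L_N(x,x')=0$ for $|x-x'|\ge 2$, and whose diagonal entries are such that all row sums vanish. For an integer $M\ge 0$, the Yule (pure-death) generator $D_M$ is the $\{0,\dots,M\}\times\{0,\dots,M\}$ matrix with off-diagonal entries $D_M(x,x-1)=x$ and $D_M(x,x')=0$ for $x'\notin\{x,x-1\}$, and diagonal entries such that all row sums vanish. A Markov kernel from a finite set $W$ to a finite set $V$ is a $W\times V$ matrix with non-negative entries and all row sums equal to $1$. *)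

theory Defs
  imports "Jordan_Normal_Form.Matrix"
begin

text \<open>The state space \<open>{0,\<dots>,n}\<close> is the index set \<open>{0..<n + 1}\<close> of a matrix of dimension \<open>n + 1\<close>.\<close>

definition generator_of :: "nat \<Rightarrow> (nat \<Rightarrow> nat \<Rightarrow> real) \<Rightarrow> real mat" where
  "generator_of n r = mat (n + 1) (n + 1)
     (\<lambda>(x, y). if x = y then - (\<Sum>z\<in>{0..n} - {x}. r x z) else r x y)"

definition ehrenfest_generator :: "nat \<Rightarrow> real mat" where
  "ehrenfest_generator N = generator_of N
     (\<lambda>x y. if y = x + 1 then (real N - real x) / 2
            else if x = y + 1 then real x / 2
            else 0)"

definition yule_generator :: "nat \<Rightarrow> real mat" where
  "yule_generator M = generator_of M (\<lambda>x y. if x = y + 1 then real x else 0)"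

definition markov_kernel :: "nat \<Rightarrow> nat \<Rightarrow> real mat \<Rightarrow> bool" where
  "markov_kernel N M K \<longleftrightarrow>
     K \<in> carrier_mat (N + 1) (M + 1) \<and>
     (\<forall>x\<in>{0..N}. \<forall>y\<in>{0..M}. K $$ (x, y) \<ge> 0) \<and>
     (\<forall>x\<in>{0..N}. (\<Sum>y=0..M. K $$ (x, y)) = 1)"

definition prob_distribution :: "nat \<Rightarrow> real vec \<Rightarrow> bool" where
  "prob_distribution M \<nu> \<longleftrightarrow>
     \<nu> \<in> carrier_vec (M + 1) \<and> (\<forall>y\<in>{0..M}. \<nu> $ y \<ge> 0) \<and> (\<Sum>y=0..M. \<nu> $ y) = 1"

definition trivial_kernel :: "nat \<Rightarrow> nat \<Rightarrow> real mat \<Rightarrow> bool" where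
  "trivial_kernel N M K \<longleftrightarrow> (\<exists>\<nu>. prob_distribution M \<nu> \<and> (\<forall>x\<in>{0..N}. row K x = \<nu>))"

end

theory Submission
  imports Defs
begin

text \<open>
  The binomial weights \<open>\<pi>\<close> are reversible for the Ehrenfest generator, so \<open>\<pi> L = 0\<close>, and any
  intertwining kernel satisfies \<open>(\<pi> \<Lambda>) D = \<pi> L \<Lambda> = 0\<close>. Hence \<open>\<pi> \<Lambda>\<close> is invariant for the Yule
  generator, which is absorbed at \<open>0\<close>, and so \<open>\<pi> \<Lambda>\<close> charges only \<open>0\<close>. As the weights are positive,
  all rows of \<open>\<Lambda>\<close> are the Dirac mass at \<open>0\<close>.
\<close>

lemma generator_of_carrier: "generator_of n r \<in> carrier_mat (n + 1) (n + 1)"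
  by (simp add: generator_of_def)

lemma generator_of_row_sum:
  assumes "x \<le> n"
  shows "(\<Sum>z=0..n. generator_of n r $$ (x, z)) = 0"
proof -
  have "(\<Sum>z=0..n. generator_of n r $$ (x, z))
      = generator_of n r $$ (x, x) + (\<Sum>z\<in>{0..n} - {x}. generator_of n r $$ (x, z))"
    using assms by (intro sum.remove) auto
  also have "(\<Sum>z\<in>{0..n} - {x}. generator_of n r $$ (x, z)) = (\<Sum>z\<in>{0..n} - {x}. r x z)"
    using assms by (intro sum.cong) (auto simp: generator_of_def)
  finally show ?thesis
    using assms by (simp add: generator_of_def)
qed

text \<open>Detailed balance turns column \<open>z\<close>, weighted by \<open>w\<close>, into
  \<open>w z\<close> times row \<open>z\<close>, and row sums of a generator vanish. The diagonal
  entry agrees on both sides.\<close>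

lemma generator_of_invariant:
  fixes w :: "nat \<Rightarrow> real"
  assumes reversible: "\<And>x z. x \<le> n \<Longrightarrow> z \<le> n \<Longrightarrow> x \<noteq> z \<Longrightarrow> w x * r x z = w z * r z x"
    and "z \<le> n"
  shows "(\<Sum>x=0..n. w x * generator_of n r $$ (x, z)) = 0"
proof -
  have "(\<Sum>x=0..n. w x * generator_of n r $$ (x, z))
      = (\<Sum>x=0..n. w z * generator_of n r $$ (z, x))"
    using assms by (intro sum.cong) (auto simp: generator_of_def)
  also have "\<dots> = 0"
    using generator_of_row_sum[OF \<open>z \<le> n\<close>] by (simp flip: sum_distrib_left)
  finally show ?thesis .
qed

text \<open>Both sides equal \<open>N\<close> times the binomial coefficient of \<open>N - 1\<close>
  over \<open>x\<close>. Up to the factor 1/2 this is detailed balance across the edge between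
  \<open>x\<close> and \<open>x + 1\<close>.\<close>

lemma binomial_absorb_real:
  assumes "x < N"
  shows "real (N choose x) * (real N - real x) = real (N choose Suc x) * real (Suc x)"
proof -
  have "(N choose x) * (N - x) = (N choose Suc x) * Suc x"
    using binomial_absorb_comp[of N x] binomial_absorption[of x N]
    by (metis mult.commute)
  then have "real ((N choose x) * (N - x)) = real ((N choose Suc x) * Suc x)"
    by (rule arg_cong)
  then show ?thesis
    using assms by (simp only: of_nat_mult of_nat_diff less_imp_le)
qed

lemma ehrenfest_invariant:
  assumes "z \<le> N"
  shows "(\<Sum>x=0..N. real (N choose x) * ehrenfest_generator N $$ (x, z)) = 0"
  unfolding ehrenfest_generator_def
proof (rule generator_of_invariant[OF _ assms])
  fix x z :: nat
  assume "x \<le> N" "z \<le> N"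
  then show "real (N choose x) * (if z = x + 1 then (real N - real x) / 2
        else if x = z + 1 then real x / 2 else 0)
      = real (N choose z) * (if x = z + 1 then (real N - real z) / 2
        else if z = x + 1 then real z / 2 else 0)"
    \<comment> \<open>The two instances serve an upward and a downward step; without a step both
      sides are 0.\<close>
    using binomial_absorb_real[of x N] binomial_absorb_real[of z N] by auto
qed

lemma yule_generator_entry:
  assumes "x \<le> M" "y \<le> M"
  shows "yule_generator M $$ (x, y) = (if x = y then - real x else if x = Suc y then real x else 0)"
proof -
  have "(\<Sum>z\<in>{0..M} - {x}. if x = z + 1 then real x else 0) = real x"
  \<comment> \<open>From 0 there is no state below, so the sum is 0, which is also the rate; from
    \<open>Suc k\<close> the only target is \<open>k\<close>.\<close>
  proof (cases x)
    case (Suc k)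
    then have "(\<Sum>z\<in>{0..M} - {x}. if x = z + 1 then real x else 0)
        = (\<Sum>z\<in>{k}. if x = z + 1 then real x else 0)"
      using assms by (intro sum.mono_neutral_right) auto
    then show ?thesis using Suc by simp
  qed simp
  then show ?thesis
    using assms by (auto simp: yule_generator_def generator_of_def)
qed

lemma index_mult_mat_sum:
  assumes "A \<in> carrier_mat (m + 1) (n + 1)" "B \<in> carrier_mat (n + 1) (k + 1)" "i \<le> m" "j \<le> k"
  shows "(A * B) $$ (i, j) = (\<Sum>l=0..n. A $$ (i, l) * B $$ (l, j))"
proof -
  have "{0..<n + 1} = {0..n}" by auto
  then show ?thesis
    using assms by (auto simp: scalar_prod_def intro!: sum.cong)
qed

lemma ehrenfest_carrier: "ehrenfest_generator N \<in> carrier_mat (N + 1) (N + 1)"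
  unfolding ehrenfest_generator_def by (rule generator_of_carrier)

lemma yule_carrier: "yule_generator M \<in> carrier_mat (M + 1) (M + 1)"
  unfolding yule_generator_def by (rule generator_of_carrier)

definition dirac_kernel :: "nat \<Rightarrow> nat \<Rightarrow> real mat" where
  "dirac_kernel N M = mat (N + 1) (M + 1) (\<lambda>(x, y). if y = 0 then 1 else 0)"

lemma dirac_kernel_carrier: "dirac_kernel N M \<in> carrier_mat (N + 1) (M + 1)"
  unfolding dirac_kernel_def by (rule mat_carrier)

lemma dirac_kernel_entry:
  "x \<le> N \<Longrightarrow> y \<le> M \<Longrightarrow> dirac_kernel N M $$ (x, y) = (if y = 0 then 1 else 0)"
  by (simp add: dirac_kernel_def)

lemma dirac_kernel_markov: "markov_kernel N M (dirac_kernel N M)"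
  unfolding markov_kernel_def using dirac_kernel_carrier by (auto simp: dirac_kernel_entry)

lemma dirac_kernel_trivial: "trivial_kernel N M (dirac_kernel N M)"
proof -
  have "prob_distribution M (unit_vec (M + 1) 0)"
    by (auto simp: prob_distribution_def)
  moreover have "\<forall>x\<in>{0..N}. row (dirac_kernel N M) x = unit_vec (M + 1) 0"
    by (auto simp: dirac_kernel_def)
  ultimately show ?thesis
    unfolding trivial_kernel_def by blast
qed

text \<open>Both products are zero: each column of the kernel is constant, and the Ehrenfest
  generator kills constants; each row sits at the absorbing state 0, whose row in the Yule generator
  vanishes.\<close>

lemma dirac_kernel_intertwines:
  "ehrenfest_generator N * dirac_kernel N M = dirac_kernel N M * yule_generator M"
proof (rule eq_matI)
  fix x y
  assume "x < dim_row (dirac_kernel N M * yule_generator M)"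
    and "y < dim_col (dirac_kernel N M * yule_generator M)"
  then have x: "x \<le> N" and y: "y \<le> M"
    using dirac_kernel_carrier[of N M] yule_carrier[of M] by auto
  have "(ehrenfest_generator N * dirac_kernel N M) $$ (x, y)
      = (\<Sum>z=0..N. ehrenfest_generator N $$ (x, z) * (if y = 0 then 1 else 0))"
    unfolding index_mult_mat_sum[OF ehrenfest_carrier dirac_kernel_carrier x y]
    using y by (intro sum.cong) (auto simp: dirac_kernel_entry)
  also have "\<dots> = 0"
    using generator_of_row_sum[OF x] by (auto simp: ehrenfest_generator_def simp flip: sum_distrib_right)
  also have "0 = (\<Sum>z=0..M. dirac_kernel N M $$ (x, z) * yule_generator M $$ (z, y))"
    using x y by (intro sum.neutral[symmetric]) (auto simp: dirac_kernel_entry yule_generator_entry)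
  also have "\<dots> = (dirac_kernel N M * yule_generator M) $$ (x, y)"
    by (rule index_mult_mat_sum[OF dirac_kernel_carrier yule_carrier x y, symmetric])
  finally show "(ehrenfest_generator N * dirac_kernel N M) $$ (x, y)
      = (dirac_kernel N M * yule_generator M) $$ (x, y)" .
qed (use dirac_kernel_carrier[of N M] yule_carrier[of M] ehrenfest_carrier[of N] in auto)

text \<open>Column \<open>y\<close> of the invariance equation says that the flow into
  \<open>y\<close> from \<open>Suc y\<close> equals the flow \<open>real y * \<mu> y\<close> out of
  \<open>y\<close>. No mass leaves 0, so by induction all these flows vanish. Stating the claim for
  the flow makes the case \<open>y = 0\<close> immediate.\<close>

lemma yule_invariant_supported_at_0:
  fixes \<mu> :: "nat \<Rightarrow> real"
  assumes inv: "\<And>y. y \<le> M \<Longrightarrow> (\<Sum>x=0..M. \<mu> x * yule_generator M $$ (x, y)) = 0"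
    and "y \<le> M"
  shows "real y * \<mu> y = 0"
  using \<open>y \<le> M\<close>
proof (induction y)
  case (Suc y)
  have "0 = (\<Sum>x=0..M. \<mu> x * yule_generator M $$ (x, y))"
    using inv Suc.prems by simp
  also have "\<dots> = (\<Sum>x\<in>{y, Suc y}. \<mu> x * yule_generator M $$ (x, y))"
    using Suc.prems by (intro sum.mono_neutral_right) (auto simp: yule_generator_entry)
  also have "\<dots> = - (real y * \<mu> y) + real (Suc y) * \<mu> (Suc y)"
    using Suc.prems by (simp add: yule_generator_entry)
  finally show ?case
    using Suc by simp
qed simp

lemma intertwining_kernel_eq_dirac:
  assumes K: "markov_kernel N M K"
    and eq: "ehrenfest_generator N * K = K * yule_generator M"
  shows "K = dirac_kernel N M"
proof -
  \<comment> \<open>The row vector \<pi>\<Lambda> of the overview, with \<pi> left unnormalised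
    since only the vanishing of its entries matters.\<close>
  define \<mu> where "\<mu> y = (\<Sum>x=0..N. real (N choose x) * K $$ (x, y))" for y
  have KC: "K \<in> carrier_mat (N + 1) (M + 1)"
    and nonneg: "\<And>x y. x \<le> N \<Longrightarrow> y \<le> M \<Longrightarrow> 0 \<le> K $$ (x, y)"
    and row_sum: "\<And>x. x \<le> N \<Longrightarrow> (\<Sum>y=0..M. K $$ (x, y)) = 1"
    using K by (auto simp: markov_kernel_def)
  have inv: "(\<Sum>z=0..M. \<mu> z * yule_generator M $$ (z, y)) = 0" if y: "y \<le> M" for y
  proof -
    \<comment> \<open>Exchanging sums is associativity: (\<pi>K)D = \<pi>(KD) = \<pi>(LK) =
      (\<pi>L)K = 0.\<close>
    have "(\<Sum>z=0..M. \<mu> z * yule_generator M $$ (z, y))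
        = (\<Sum>x=0..N. real (N choose x) * (\<Sum>z=0..M. K $$ (x, z) * yule_generator M $$ (z, y)))"
      unfolding \<mu>_def sum_distrib_left sum_distrib_right mult.assoc by (rule sum.swap)
    also have "\<dots> = (\<Sum>x=0..N. real (N choose x) *
        (\<Sum>z=0..N. ehrenfest_generator N $$ (x, z) * K $$ (z, y)))"
      using y eq index_mult_mat_sum[OF KC yule_carrier] index_mult_mat_sum[OF ehrenfest_carrier KC]
      by (intro sum.cong) (auto simp del: One_nat_def)
    also have "\<dots> = (\<Sum>z=0..N.
        (\<Sum>x=0..N. real (N choose x) * ehrenfest_generator N $$ (x, z)) * K $$ (z, y))"
      unfolding sum_distrib_left sum_distrib_right mult.assoc by (rule sum.swap)
    also have "\<dots> = 0"
      by (intro sum.neutral) (simp add: ehrenfest_invariant)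
    finally show ?thesis .
  qed
  have zero: "K $$ (x, y) = 0" if "x \<le> N" "y \<le> M" "y \<noteq> 0" for x y
  proof -
    have "\<mu> y = 0"
      using yule_invariant_supported_at_0[OF inv \<open>y \<le> M\<close>] \<open>y \<noteq> 0\<close> by simp
    \<comment> \<open>A vanishing sum of nonnegative terms has only zero terms, and the binomial
      weights are positive for \<open>x \<le> N\<close>.\<close>
    then have "\<forall>x\<in>{0..N}. real (N choose x) * K $$ (x, y) = 0"
      unfolding \<mu>_def using nonneg \<open>y \<le> M\<close>
      by (subst (asm) sum_nonneg_eq_0_iff) auto
    then show ?thesis
      using \<open>x \<le> N\<close> by auto
  qed
  have one: "K $$ (x, 0) = 1" if "x \<le> N" for x
  proof -
    \<comment> \<open>With all other entries zero, the whole mass 1 of the row lies at 0.\<close>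
    have "(\<Sum>y=0..M. K $$ (x, y)) = (\<Sum>y\<in>{0}. K $$ (x, y))"
      using zero that by (intro sum.mono_neutral_right) auto
    then show ?thesis
      using row_sum[OF that] by simp
  qed
  show ?thesis
    using KC zero one by (intro eq_matI) (auto simp: dirac_kernel_def)
qed

theorem mainTheorem6:
  fixes N M :: nat
  shows "(\<exists>!\<Lambda>. markov_kernel N M \<Lambda> \<and> ehrenfest_generator N * \<Lambda> = \<Lambda> * yule_generator M) \<and>
    (\<forall>\<Lambda>. markov_kernel N M \<Lambda> \<and> ehrenfest_generator N * \<Lambda> = \<Lambda> * yule_generator M \<longrightarrow>
      trivial_kernel N M \<Lambda>)"
  using dirac_kernel_markov dirac_kernel_intertwines dirac_kernel_trivial
    intertwining_kernel_eq_dirac by metis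

end
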